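(* Let $a\in L^1(I)$ and $\lambda\in\mathbb{R}$. If $L[\lambda]$ is nonresonant both in $X_D$ and in $X_{M_1}$, then for all $(t,s)\in I\times I$ $$G_{M_1}[\lambda](t,s)=G_D[\lambda](t,s)+r_1[\lambda](t)\,G_{M_1}[\lambda](0,s)$$ $$=G_D[\lambda](t,s)-\frac{\partial}{\partial s}G_D[\lambda](t,0)\,G_{M_1}[\lambda](0,s).$$
   Context: $I=[0,1]$, $a\in L^1(I)$ is real-valued, $\lambda\in\mathbb{R}$, and $L[\lambda]u(t)=u''(t)+(a(t)+\lambda)u(t)$. $W^{2,1}(I)=\{u\in C(I):u'\in AC(I)\}$, where $AC(I)$ is the set of absolutely continuous functions on $I$. $X_D=\{u\in W^{2,1}(I):u(0)=u(1)=0\}$ (Dirichlet) and $X_{M_1}=\{u\in W^{2,1}(I):u'(0)=u(1)=0\}$ (Mixed 1). $L[\lambda]$ is nonresonant in $X$ if $u=0$ is the only $u\in X$ with $L[\lambda]u=0$ a.e. on $I$. In that case, for every $\sigma\in L^1(I)$ the problem $L[\lambda]u=\sigma$ a.e. on $I$, $u\in X$, has a unique solution, given by $u(t)=\int_0^1G(t,s)\sigma(s)\,ds$, where the continuous function $G:I\times I\to\mathbb{R}$ is the Green's function; it is denoted $G_D[\lambda]$ for $X=X_D$ and $G_{M_1}[\lambda]$ for $X=X_{M_1}$. $r_1[\lambda]$ is the unique solution of $L[\lambda]u=0$ a.e. on $I$, $u(0)=1$, $u(1)=0$. Convention: $\frac{\partial}{\partial s}G(t,0)$ is the (one-sided) derivative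 for $t\in(0,1)$, extended by continuity to $t\in\{0,1\}$. *)

theory Defs
  imports "HOL-Analysis.Analysis"
begin

text \<open>
  A function on the unit interval is a function on the reals of which only the values
  on \<open>unit_I\<close> matter. Derivatives at the end points are one-sided (\<open>at t within unit_I\<close>).
\<close>

abbreviation unit_I :: "real set" where
  "unit_I \<equiv> {0..1}"

text \<open>
  The constant \<open>absolutely_continuous\<close> of HOL-Analysis concerns measures. This is the
  notion for functions.
\<close>

definition abs_continuous_on :: "real set \<Rightarrow> (real \<Rightarrow> real) \<Rightarrow> bool" where
  "abs_continuous_on S f \<longleftrightarrow>
     (\<forall>\<epsilon>>0. \<exists>\<delta>>0. \<forall>(n::nat) (x :: nat \<Rightarrow> real) (y :: nat \<Rightarrow> real).
        (\<forall>k<n. x k \<le> y k \<and> {x k..y k} \<subseteq> S) \<longrightarrow>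
        disjoint_family_on (\<lambda>k. {x k<..<y k}) {..<n} \<longrightarrow>
        (\<Sum>k<n. y k - x k) < \<delta> \<longrightarrow>
        (\<Sum>k<n. \<bar>f (y k) - f (x k)\<bar>) < \<epsilon>)"

definition D1 :: "(real \<Rightarrow> real) \<Rightarrow> real \<Rightarrow> real" where
  "D1 u t = vector_derivative u (at t within unit_I)"

definition W21 :: "(real \<Rightarrow> real) set" where
  "W21 = {u. continuous_on unit_I u \<and> u differentiable_on unit_I \<and>
             abs_continuous_on unit_I (D1 u)}"

definition X_D :: "(real \<Rightarrow> real) set" where
  "X_D = {u \<in> W21. u 0 = 0 \<and> u 1 = 0}"

definition X_M1 :: "(real \<Rightarrow> real) set" where
  "X_M1 = {u \<in> W21. D1 u 0 = 0 \<and> u 1 = 0}"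

definition hill_L :: "(real \<Rightarrow> real) \<Rightarrow> real \<Rightarrow> (real \<Rightarrow> real) \<Rightarrow> real \<Rightarrow> real" where
  "hill_L a lam u t = D1 (D1 u) t + (a t + lam) * u t"

text \<open>
  The operator is meaningful only where the second derivative exists, so an
  equation that holds almost everywhere includes this existence. For \<open>u\<close> in \<open>W21\<close> it
  is no restriction, as an absolutely continuous function is differentiable
  almost everywhere.
\<close>

definition solves_ae ::
    "(real \<Rightarrow> real) \<Rightarrow> real \<Rightarrow> (real \<Rightarrow> real) \<Rightarrow> (real \<Rightarrow> real) \<Rightarrow> bool" where
  "solves_ae a lam \<sigma> u \<longleftrightarrow>
     (AE t in lebesgue_on unit_I.
        D1 u differentiable (at t within unit_I) \<and> hill_L a lam u t = \<sigma> t)"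

definition nonresonant :: "(real \<Rightarrow> real) \<Rightarrow> real \<Rightarrow> (real \<Rightarrow> real) set \<Rightarrow> bool" where
  "nonresonant a lam X \<longleftrightarrow>
     (\<forall>u\<in>X. solves_ae a lam (\<lambda>t. 0) u \<longrightarrow> (\<forall>t\<in>unit_I. u t = 0))"

text \<open>
  Under nonresonance the solution in \<open>X\<close> is unique on \<open>unit_I\<close>. By continuity, the
  following then determines \<open>G\<close> on \<open>unit_I \<times> unit_I\<close>.
\<close>

definition is_Green ::
    "(real \<Rightarrow> real) \<Rightarrow> real \<Rightarrow> (real \<Rightarrow> real) set \<Rightarrow> (real \<Rightarrow> real \<Rightarrow> real) \<Rightarrow> bool" where
  "is_Green a lam X G \<longleftrightarrow>
     continuous_on (unit_I \<times> unit_I) (\<lambda>(t, s). G t s) \<and>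
     (\<forall>\<sigma>. \<sigma> absolutely_integrable_on unit_I \<longrightarrow>
        (let u = (\<lambda>t. LINT s:unit_I|lebesgue. G t s * \<sigma> s)
         in u \<in> X \<and> solves_ae a lam \<sigma> u))"

definition is_r1 :: "(real \<Rightarrow> real) \<Rightarrow> real \<Rightarrow> (real \<Rightarrow> real) \<Rightarrow> bool" where
  "is_r1 a lam u \<longleftrightarrow> u \<in> W21 \<and> solves_ae a lam (\<lambda>t. 0) u \<and> u 0 = 1 \<and> u 1 = 0"

text \<open>
  \<open>ds0 G t\<close> is the derivative of \<open>G\<close> with respect to \<open>s\<close> at \<open>(t, 0)\<close>. For \<open>t\<close> strictly
  between 0 and 1 it is the right-hand derivative; at the end points it is the limit
  from inside the interval. The constants \<open>vector_derivative\<close> and \<open>Lim\<close> are total, so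
  \<open>ds0_exists\<close> says that these derivatives and limits exist.
\<close>

definition ds0 :: "(real \<Rightarrow> real \<Rightarrow> real) \<Rightarrow> real \<Rightarrow> real" where
  "ds0 G t =
     (if t \<in> {0<..<1} then vector_derivative (G t) (at 0 within unit_I)
      else Lim (at t within {0<..<1}) (\<lambda>\<tau>. vector_derivative (G \<tau>) (at 0 within unit_I)))"

definition ds0_exists :: "(real \<Rightarrow> real \<Rightarrow> real) \<Rightarrow> bool" where
  "ds0_exists G \<longleftrightarrow>
     (\<forall>t\<in>{0<..<1}. G t differentiable (at 0 within unit_I)) \<and>
     (\<forall>t\<in>{0,1}. ((\<lambda>\<tau>. vector_derivative (G \<tau>) (at 0 within unit_I)) \<longlongrightarrow> ds0 G t)
                  (at t within {0<..<1}))"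

end

theory Submission
  imports Defs
begin

text \<open>
  The first identity is uniqueness of the Dirichlet problem. For a continuous \<open>\<sigma>\<close> let
  \<open>u\<close> and \<open>v\<close> be the solutions of \<open>L u = \<sigma>\<close> that the two Green's functions produce in
  \<open>X_M1\<close> and \<open>X_D\<close>. Then \<open>u\<close> and \<open>v + u 0 * r1\<close> solve the same equation and agree at
  both end points, so they coincide. Written as integrals, the difference of the two
  kernels is orthogonal to every continuous \<open>\<sigma>\<close>, in particular to itself
  (\<open>Green_M1_eq\<close>).

  The second identity says that \<open>G_D t\<close> has derivative \<open>- r1 t\<close> at 0. Classically,
  \<open>G_D t s = - r1 t * \<phi> s\<close> for \<open>s \<le> t\<close>, where \<open>\<phi>\<close> is the homogeneous solution with
  \<open>\<phi> 0 = 0\<close> and \<open>\<phi>' 0 = 1\<close>. The derivative depends only on small \<open>s\<close>, where \<open>r1\<close> is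
  positive and reduction of order expresses \<open>\<phi>\<close> by \<open>r1\<close>: it is \<open>r1 * \<Phi>\<close> with
  \<open>\<Phi>' = 1 / r1\<^sup>2\<close>. That the kernel has this form follows from explicit Dirichlet solutions
  \<open>r1 * w\<close> with \<open>w 0 = 0\<close> and \<open>w\<close> constant to the right of a small \<open>c \<le> t\<close>. Since
  \<open>L (r1 * w) = (r1\<^sup>2 * w')' / r1\<close>, the right-hand side can be any continuous function
  that vanishes on \<open>{c..1}\<close>; comparing \<open>r1 * w\<close> at \<open>t\<close> with its representation by
  \<open>G_D\<close> determines \<open>G_D t\<close> on \<open>{0..<c}\<close> (\<open>Green_D_near_0\<close>).
\<close>

section \<open>Absolutely continuous functions\<close>

lemma abs_continuous_onD:
  assumes "abs_continuous_on S f" and "\<epsilon> > 0"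
  shows "\<exists>\<delta>>0. \<forall>(n::nat) (x :: nat \<Rightarrow> real) (y :: nat \<Rightarrow> real).
        (\<forall>k<n. x k \<le> y k \<and> {x k..y k} \<subseteq> S) \<longrightarrow>
        disjoint_family_on (\<lambda>k. {x k<..<y k}) {..<n} \<longrightarrow>
        (\<Sum>k<n. y k - x k) < \<delta> \<longrightarrow>
        (\<Sum>k<n. \<bar>f (y k) - f (x k)\<bar>) < \<epsilon>"
  by (rule assms(1)[unfolded abs_continuous_on_def, THEN spec, THEN mp, OF assms(2)])

text \<open>
  One comparison principle yields the closure properties below: sums, products on
  compact intervals, and images under Lipschitz maps.
\<close>

lemma abs_continuous_on_dominated:
  assumes f: "abs_continuous_on S f" and g: "abs_continuous_on S g"
    and L: "L \<ge> 0"
    and h: "\<And>x y. x \<in> S \<Longrightarrow> y \<in> S \<Longrightarrow> \<bar>h y - h x\<bar> \<le> L * \<bar>f y - f x\<bar> + L * \<bar>g y - g x\<bar>"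
  shows "abs_continuous_on S h"
  unfolding abs_continuous_on_def
proof (intro allI impI)
  fix \<epsilon> :: real assume "\<epsilon> > 0"
  define \<eta> where "\<eta> = \<epsilon> / (2 * (L + 1))"
  have \<eta>: "\<eta> > 0" using \<open>\<epsilon> > 0\<close> L by (simp add: \<eta>_def)
  obtain d where d: "d > 0" and f': "\<forall>(n::nat) (x :: nat \<Rightarrow> real) (y :: nat \<Rightarrow> real).
        (\<forall>k<n. x k \<le> y k \<and> {x k..y k} \<subseteq> S) \<longrightarrow>
        disjoint_family_on (\<lambda>k. {x k<..<y k}) {..<n} \<longrightarrow>
        (\<Sum>k<n. y k - x k) < d \<longrightarrow> (\<Sum>k<n. \<bar>f (y k) - f (x k)\<bar>) < \<eta>"
    using abs_continuous_onD[OF f \<eta>] by (elim exE conjE)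
  obtain e where e: "e > 0" and g': "\<forall>(n::nat) (x :: nat \<Rightarrow> real) (y :: nat \<Rightarrow> real).
        (\<forall>k<n. x k \<le> y k \<and> {x k..y k} \<subseteq> S) \<longrightarrow>
        disjoint_family_on (\<lambda>k. {x k<..<y k}) {..<n} \<longrightarrow>
        (\<Sum>k<n. y k - x k) < e \<longrightarrow> (\<Sum>k<n. \<bar>g (y k) - g (x k)\<bar>) < \<eta>"
    using abs_continuous_onD[OF g \<eta>] by (elim exE conjE)
  show "\<exists>\<delta>>0. \<forall>(n::nat) (x :: nat \<Rightarrow> real) (y :: nat \<Rightarrow> real).
        (\<forall>k<n. x k \<le> y k \<and> {x k..y k} \<subseteq> S) \<longrightarrow>
        disjoint_family_on (\<lambda>k. {x k<..<y k}) {..<n} \<longrightarrow>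
        (\<Sum>k<n. y k - x k) < \<delta> \<longrightarrow>
        (\<Sum>k<n. \<bar>h (y k) - h (x k)\<bar>) < \<epsilon>"
  proof (intro exI[of _ "min d e"] conjI allI impI)
    show "min d e > 0" using d e by simp
    fix n and x y :: "nat \<Rightarrow> real"
    assume sub: "\<forall>k<n. x k \<le> y k \<and> {x k..y k} \<subseteq> S"
      and disj: "disjoint_family_on (\<lambda>k. {x k<..<y k}) {..<n}"
      and small: "(\<Sum>k<n. y k - x k) < min d e"
    have "(\<Sum>k<n. \<bar>h (y k) - h (x k)\<bar>)
        \<le> (\<Sum>k<n. L * \<bar>f (y k) - f (x k)\<bar> + L * \<bar>g (y k) - g (x k)\<bar>)"
      using sub by (intro sum_mono h) force+
    also have "\<dots> = L * ((\<Sum>k<n. \<bar>f (y k) - f (x k)\<bar>) + (\<Sum>k<n. \<bar>g (y k) - g (x k)\<bar>))"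
      by (simp add: sum.distrib sum_distrib_left distrib_left)
    also have "\<dots> \<le> L * (\<eta> + \<eta>)"
      using f'[THEN spec, THEN spec, THEN spec, THEN mp, THEN mp, OF sub disj]
        g'[THEN spec, THEN spec, THEN spec, THEN mp, THEN mp, OF sub disj] small L
      by (intro mult_left_mono) auto
    also have "\<dots> < (L + 1) * (\<eta> + \<eta>)"
      using \<eta> by (simp add: distrib_right)
    also have "\<dots> = \<epsilon>"
    proof -
      have "2 * ((L + 1) * \<eta>) = \<epsilon>"
        using L by (simp add: \<eta>_def add_nonneg_eq_0_iff divide_simps)
      then show ?thesis by (simp add: algebra_simps)
    qed
    finally show "(\<Sum>k<n. \<bar>h (y k) - h (x k)\<bar>) < \<epsilon>" .
  qed
qed

lemma abs_continuous_on_cong: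
  assumes "abs_continuous_on S f" and "\<And>x. x \<in> S \<Longrightarrow> f x = g x"
  shows "abs_continuous_on S g"
  by (rule abs_continuous_on_dominated[OF assms(1) assms(1), of 1]) (simp_all add: assms(2))

lemma abs_continuous_on_ident: "abs_continuous_on S (\<lambda>x. x)"
  unfolding abs_continuous_on_def
proof (intro allI impI exI conjI)
  fix \<epsilon> :: real and n and x y :: "nat \<Rightarrow> real"
  assume "\<forall>k<n. x k \<le> y k \<and> {x k..y k} \<subseteq> S" "(\<Sum>k<n. y k - x k) < \<epsilon>"
  moreover from this have "(\<Sum>k<n. \<bar>y k - x k\<bar>) = (\<Sum>k<n. y k - x k)"
    by (intro sum.cong) auto
  ultimately show "(\<Sum>k<n. \<bar>y k - x k\<bar>) < \<epsilon>" by simp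
qed

lemma abs_continuous_on_add_cmult:
  assumes f: "abs_continuous_on S f" and g: "abs_continuous_on S g"
  shows "abs_continuous_on S (\<lambda>x. f x + k * g x)"
proof (rule abs_continuous_on_dominated[OF f g, of "1 + \<bar>k\<bar>"])
  fix x y
  have "\<bar>(f y + k * g y) - (f x + k * g x)\<bar> = \<bar>(f y - f x) + k * (g y - g x)\<bar>"
    by (simp add: algebra_simps)
  also have "\<dots> \<le> \<bar>f y - f x\<bar> + \<bar>k\<bar> * \<bar>g y - g x\<bar>"
    by (metis abs_mult abs_triangle_ineq)
  also have "\<dots> \<le> (1 + \<bar>k\<bar>) * \<bar>f y - f x\<bar> + (1 + \<bar>k\<bar>) * \<bar>g y - g x\<bar>"
    by (simp add: distrib_right)
  finally show "\<bar>(f y + k * g y) - (f x + k * g x)\<bar>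
      \<le> (1 + \<bar>k\<bar>) * \<bar>f y - f x\<bar> + (1 + \<bar>k\<bar>) * \<bar>g y - g x\<bar>" .
qed simp

lemma abs_continuous_on_imp_continuous_on:
  assumes f: "abs_continuous_on {a..b} f"
  shows "continuous_on {a..b} f"
  unfolding continuous_on_iff
proof (intro ballI allI impI)
  fix x and \<epsilon> :: real assume x: "x \<in> {a..b}" and \<epsilon>: "\<epsilon> > 0"
  obtain \<delta> where \<delta>: "\<delta> > 0" and f': "\<forall>(n::nat) (x :: nat \<Rightarrow> real) (y :: nat \<Rightarrow> real).
        (\<forall>k<n. x k \<le> y k \<and> {x k..y k} \<subseteq> {a..b}) \<longrightarrow>
        disjoint_family_on (\<lambda>k. {x k<..<y k}) {..<n} \<longrightarrow>
        (\<Sum>k<n. y k - x k) < \<delta> \<longrightarrow> (\<Sum>k<n. \<bar>f (y k) - f (x k)\<bar>) < \<epsilon>"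
    using abs_continuous_onD[OF f \<epsilon>] by (elim exE conjE)
  have one: "\<bar>f v - f u\<bar> < \<epsilon>" if "u \<in> {a..b}" "v \<in> {a..b}" "u \<le> v" "v - u < \<delta>" for u v
  proof -
    have "disjoint_family_on (\<lambda>k::nat. {u<..<v}) {..<Suc 0}"
      by (simp add: disjoint_family_on_def)
    moreover have "\<forall>k<Suc 0. u \<le> v \<and> {u..v} \<subseteq> {a..b}"
      using that by auto
    moreover have "(\<Sum>k<Suc 0. v - u) < \<delta>"
      using that by simp
    ultimately have "(\<Sum>k<Suc 0. \<bar>f v - f u\<bar>) < \<epsilon>"
      using f'[THEN spec[of _ "Suc 0"], THEN spec[of _ "\<lambda>_. u"], THEN spec[of _ "\<lambda>_. v"]]
      by blast
    then show ?thesis by simp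
  qed
  show "\<exists>d>0. \<forall>x'\<in>{a..b}. dist x' x < d \<longrightarrow> dist (f x') (f x) < \<epsilon>"
  proof (intro exI[of _ \<delta>] conjI \<delta> ballI impI)
    fix x' assume "x' \<in> {a..b}" "dist x' x < \<delta>"
    then show "dist (f x') (f x) < \<epsilon>"
      using one[of x x'] one[of x' x] x by (cases "x \<le> x'") (auto simp: dist_real_def)
  qed
qed

lemma continuous_on_Icc_bound:
  fixes f :: "real \<Rightarrow> real"
  assumes "continuous_on {a..b} f"
  obtains B where "B \<ge> 0" "\<And>x. x \<in> {a..b} \<Longrightarrow> \<bar>f x\<bar> \<le> B"
proof -
  have "bounded (f ` {a..b})"
    using assms compact_continuous_image compact_imp_bounded by blast
  then obtain B where "\<forall>x\<in>{a..b}. \<bar>f x\<bar> \<le> B"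
    by (auto simp: bounded_iff)
  then show ?thesis
    by (intro that[of "\<bar>B\<bar>"]) force+
qed

lemma abs_continuous_on_mult:
  assumes f: "abs_continuous_on {a..b} f" and g: "abs_continuous_on {a..b} g"
  shows "abs_continuous_on {a..b} (\<lambda>x. f x * g x)"
proof -
  obtain A where A: "A \<ge> 0" "\<And>x. x \<in> {a..b} \<Longrightarrow> \<bar>f x\<bar> \<le> A"
    using continuous_on_Icc_bound[OF abs_continuous_on_imp_continuous_on[OF f]] by blast
  obtain B where B: "B \<ge> 0" "\<And>x. x \<in> {a..b} \<Longrightarrow> \<bar>g x\<bar> \<le> B"
    using continuous_on_Icc_bound[OF abs_continuous_on_imp_continuous_on[OF g]] by blast
  show ?thesis
  proof (rule abs_continuous_on_dominated[OF f g, of "A + B"])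
    fix x y assume xy: "x \<in> {a..b}" "y \<in> {a..b}"
    have "\<bar>f y * g y - f x * g x\<bar> = \<bar>(f y - f x) * g y + f x * (g y - g x)\<bar>"
      by (simp add: algebra_simps)
    also have "\<dots> \<le> \<bar>f y - f x\<bar> * \<bar>g y\<bar> + \<bar>f x\<bar> * \<bar>g y - g x\<bar>"
      by (metis abs_mult abs_triangle_ineq)
    also have "\<dots> \<le> \<bar>f y - f x\<bar> * (A + B) + (A + B) * \<bar>g y - g x\<bar>"
      using A(1) B(1) A(2)[OF xy(1)] B(2)[OF xy(2)]
      by (intro add_mono mult_left_mono mult_right_mono) auto
    finally show "\<bar>f y * g y - f x * g x\<bar> \<le> (A + B) * \<bar>f y - f x\<bar> + (A + B) * \<bar>g y - g x\<bar>"
      by (simp add: mult.commute)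
  qed (use A B in auto)
qed

lemma C1_imp_abs_continuous_on:
  assumes f: "\<And>x. x \<in> {a..b} \<Longrightarrow> (f has_real_derivative f' x) (at x within {a..b})"
    and f': "continuous_on {a..b} f'"
  shows "abs_continuous_on {a..b} f"
proof -
  obtain B where B: "B \<ge> 0" "\<And>x. x \<in> {a..b} \<Longrightarrow> \<bar>f' x\<bar> \<le> B"
    using continuous_on_Icc_bound[OF f'] by blast
  show ?thesis
  proof (rule abs_continuous_on_dominated[OF abs_continuous_on_ident abs_continuous_on_ident B(1)])
    fix x y assume xy: "x \<in> {a..b}" "y \<in> {a..b}"
    have "\<bar>f y - f x\<bar> \<le> B * \<bar>y - x\<bar>"
      using field_differentiable_bound[of "{a..b}" f f' B y x] f B(2) xy by simp
    also have "\<dots> \<le> B * \<bar>y - x\<bar> + B * \<bar>y - x\<bar>"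
      using B(1) by simp
    finally show "\<bar>f y - f x\<bar> \<le> B * \<bar>y - x\<bar> + B * \<bar>y - x\<bar>" .
  qed
qed

section \<open>Linear structure of the boundary value problem\<close>

lemma D1_eqI:
  assumes "(u has_real_derivative d) (at t within unit_I)" "t \<in> unit_I"
  shows "D1 u t = d"
  unfolding D1_def using assms
  by (intro vector_derivative_within_closed_interval)
     (auto simp: has_real_derivative_iff_has_vector_derivative)

lemma has_derivative_D1:
  assumes "u differentiable (at t within unit_I)" "t \<in> unit_I"
  shows "(u has_real_derivative D1 u t) (at t within unit_I)"
proof -
  obtain d where d: "(u has_real_derivative d) (at t within unit_I)"
    using assms(1) by (auto simp: real_differentiable_def)
  then show ?thesis
    using D1_eqI[OF d assms(2)] by simp
qed

lemma W21_has_derivative: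
  assumes "u \<in> W21" "t \<in> unit_I"
  shows "(u has_real_derivative D1 u t) (at t within unit_I)"
  using assms has_derivative_D1 unfolding W21_def differentiable_on_def by auto

lemma W21I:
  assumes u: "\<And>t. t \<in> unit_I \<Longrightarrow> (u has_real_derivative u' t) (at t within unit_I)"
    and u': "abs_continuous_on unit_I u'"
  shows "u \<in> W21"
proof -
  have "D1 u t = u' t" if "t \<in> unit_I" for t
    using D1_eqI u that by blast
  then have "abs_continuous_on unit_I (D1 u)"
    using abs_continuous_on_cong[OF u'] by simp
  moreover have "u differentiable_on unit_I"
    using u unfolding differentiable_on_def real_differentiable_def by blast
  ultimately show ?thesis
    by (simp add: W21_def differentiable_imp_continuous_on)
qed

text \<open>
  The next two lemmas exchange \<open>solves_ae\<close> for a statement in which the second derivative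
  is given by a \<open>has_real_derivative\<close> fact, so that the derivative calculus applies.
\<close>

lemma solves_aeI:
  assumes u: "\<And>t. t \<in> unit_I \<Longrightarrow> (u has_real_derivative u' t) (at t within unit_I)"
    and eq: "AE t in lebesgue_on unit_I. t \<in> unit_I \<longrightarrow>
      (u' has_real_derivative \<sigma> t - (a t + lam) * u t) (at t within unit_I)"
  shows "solves_ae a lam \<sigma> u"
  unfolding solves_ae_def
proof (rule AE_mp[OF eq], rule AE_I2, intro impI)
  fix t assume "t \<in> space (lebesgue_on unit_I)" and
    d: "t \<in> unit_I \<longrightarrow> (u' has_real_derivative \<sigma> t - (a t + lam) * u t) (at t within unit_I)"
  then have t: "t \<in> unit_I" by simp
  have "(D1 u has_real_derivative \<sigma> t - (a t + lam) * u t) (at t within unit_I)"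
    using d t D1_eqI[OF u]
    by (auto intro: has_field_derivative_transform_within[of _ _ _ _ 1])
  then show "D1 u differentiable (at t within unit_I) \<and> hill_L a lam u t = \<sigma> t"
    using D1_eqI[of "D1 u"] t by (auto simp: hill_L_def real_differentiable_def)
qed

lemma solves_aeD:
  assumes "solves_ae a lam \<sigma> u"
  shows "AE t in lebesgue_on unit_I. t \<in> unit_I \<longrightarrow>
      (D1 u has_real_derivative \<sigma> t - (a t + lam) * u t) (at t within unit_I)"
  using assms[unfolded solves_ae_def]
proof (rule AE_mp, intro AE_I2 impI)
  fix t assume "D1 u differentiable (at t within unit_I) \<and> hill_L a lam u t = \<sigma> t" "t \<in> unit_I"
  moreover from this have "D1 (D1 u) t = \<sigma> t - (a t + lam) * u t"
    by (simp add: hill_L_def)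
  ultimately show "(D1 u has_real_derivative \<sigma> t - (a t + lam) * u t) (at t within unit_I)"
    using has_derivative_D1[of "D1 u" t] by simp
qed

lemma W21_add_cmult:
  assumes u: "u \<in> W21" and v: "v \<in> W21"
  shows "(\<lambda>t. u t + k * v t) \<in> W21"
proof (rule W21I)
  show "abs_continuous_on unit_I (\<lambda>t. D1 u t + k * D1 v t)"
    using u v by (intro abs_continuous_on_add_cmult) (auto simp: W21_def)
  show "((\<lambda>t. u t + k * v t) has_real_derivative D1 u t + k * D1 v t) (at t within unit_I)"
    if "t \<in> unit_I" for t
    using W21_has_derivative[OF u that] W21_has_derivative[OF v that]
    by (auto intro!: derivative_eq_intros)
qed

lemma solves_ae_add_cmult:
  assumes u: "u \<in> W21" "solves_ae a lam \<sigma> u" and v: "v \<in> W21" "solves_ae a lam \<tau> v"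
  shows "solves_ae a lam (\<lambda>t. \<sigma> t + k * \<tau> t) (\<lambda>t. u t + k * v t)"
proof (rule solves_aeI)
  show "((\<lambda>t. u t + k * v t) has_real_derivative D1 u t + k * D1 v t) (at t within unit_I)"
    if "t \<in> unit_I" for t
    using W21_has_derivative[OF u(1) that] W21_has_derivative[OF v(1) that]
    by (auto intro!: derivative_eq_intros)
  show "AE t in lebesgue_on unit_I. t \<in> unit_I \<longrightarrow>
      ((\<lambda>t. D1 u t + k * D1 v t) has_real_derivative
        \<sigma> t + k * \<tau> t - (a t + lam) * (u t + k * v t)) (at t within unit_I)"
    using solves_aeD[OF u(2)] solves_aeD[OF v(2)]
  proof (rule AE_mp[OF _ AE_mp], intro AE_I2 impI)
    fix t
    assume "t \<in> unit_I \<longrightarrow>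
        (D1 u has_real_derivative \<sigma> t - (a t + lam) * u t) (at t within unit_I)"
      and "t \<in> unit_I \<longrightarrow>
        (D1 v has_real_derivative \<tau> t - (a t + lam) * v t) (at t within unit_I)"
      and "t \<in> unit_I"
    then show "((\<lambda>t. D1 u t + k * D1 v t) has_real_derivative
        \<sigma> t + k * \<tau> t - (a t + lam) * (u t + k * v t)) (at t within unit_I)"
      by (auto intro!: derivative_eq_intros simp: algebra_simps)
  qed
qed

lemma nonresonant_unique:
  assumes nr: "nonresonant a lam X_D"
    and u: "u \<in> W21" "solves_ae a lam \<sigma> u" and v: "v \<in> W21" "solves_ae a lam \<sigma> v"
    and bdry: "u 0 = v 0" "u 1 = v 1" and t: "t \<in> unit_I"
  shows "u t = v t"
proof -
  have "(\<lambda>t. u t + (-1) * v t) \<in> X_D"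
    using W21_add_cmult[OF u(1) v(1), of "-1"] bdry by (simp add: X_D_def)
  moreover have "solves_ae a lam (\<lambda>t. 0) (\<lambda>t. u t + (-1) * v t)"
    using solves_ae_add_cmult[OF u v, of "-1"] by simp
  ultimately show ?thesis
    using nr t unfolding nonresonant_def by fastforce
qed

lemma Green_continuous_snd:
  assumes "is_Green a lam X G" "t \<in> unit_I"
  shows "continuous_on unit_I (G t)"
proof -
  have "continuous_on (unit_I \<times> unit_I) (\<lambda>(t, s). G t s)"
    using assms by (simp add: is_Green_def)
  then have "continuous_on unit_I (\<lambda>s. (\<lambda>(t, s). G t s) (t, s))"
    by (rule continuous_on_compose2) (use assms in \<open>auto intro!: continuous_intros\<close>)
  then show ?thesis by simp
qed

text \<open>
  The equality with the Henstock--Kurzweil integral is restricted to \<open>unit_I\<close>: for other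
  \<open>t\<close> nothing is known about the integrability of \<open>G t\<close>.
\<close>

lemma Green_solution:
  assumes G: "is_Green a lam X G" and \<sigma>: "continuous_on unit_I \<sigma>"
  obtains u where "u \<in> X" "solves_ae a lam \<sigma> u"
    "\<And>t. t \<in> unit_I \<Longrightarrow> u t = integral unit_I (\<lambda>s. G t s * \<sigma> s)"
proof -
  define u where "u = (\<lambda>t. LINT s:unit_I|lebesgue. G t s * \<sigma> s)"
  have "u \<in> X" "solves_ae a lam \<sigma> u"
    using G absolutely_integrable_continuous_real[OF \<sigma>]
    unfolding is_Green_def u_def Let_def by blast+
  moreover have "u t = integral unit_I (\<lambda>s. G t s * \<sigma> s)" if "t \<in> unit_I" for t
    unfolding u_def
    by (intro set_lebesgue_integral_eq_integral absolutely_integrable_continuous_real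
        continuous_on_mult Green_continuous_snd[OF G that] \<sigma>)
  ultimately show ?thesis using that by blast
qed

section \<open>The two Green's functions\<close>

text \<open>
  Both sides, integrated against any continuous \<open>\<sigma>\<close>, solve \<open>L u = \<sigma>\<close> with the same
  values at 0 and 1. The choice of \<open>\<sigma>\<close> as the difference \<open>F\<close> of the two sides makes
  the integral of \<open>F\<^sup>2\<close> vanish.
\<close>

lemma Green_M1_eq:
  assumes nr: "nonresonant a lam X_D"
    and GD: "is_Green a lam X_D G_D" and GM: "is_Green a lam X_M1 G_M1"
    and r1: "is_r1 a lam r1"
    and t: "t \<in> unit_I" and s: "s \<in> unit_I"
  shows "G_M1 t s = G_D t s + r1 t * G_M1 0 s"
proof -
  define F where "F = (\<lambda>s. G_M1 t s - G_D t s - r1 t * G_M1 0 s)"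
  have cM: "continuous_on unit_I (G_M1 t)" and cM0: "continuous_on unit_I (G_M1 0)"
    and cD: "continuous_on unit_I (G_D t)"
    using Green_continuous_snd[OF GM] Green_continuous_snd[OF GD] t by auto
  have F: "continuous_on unit_I F"
    unfolding F_def by (intro continuous_intros cM cM0 cD)
  \<comment> \<open>\<open>F\<close> is used as the right-hand side of the equation.\<close>
  obtain u where u: "u \<in> X_M1" "solves_ae a lam F u"
    "\<And>t. t \<in> unit_I \<Longrightarrow> u t = integral unit_I (\<lambda>s. G_M1 t s * F s)"
    using Green_solution[OF GM F] by metis
  obtain v where v: "v \<in> X_D" "solves_ae a lam F v"
    "\<And>t. t \<in> unit_I \<Longrightarrow> v t = integral unit_I (\<lambda>s. G_D t s * F s)"
    using Green_solution[OF GD F] by metis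
  have "u t = v t + u 0 * r1 t"
  proof (rule nonresonant_unique[OF nr _ _ _ _ _ _ t, where v = "\<lambda>t. v t + u 0 * r1 t"])
    have r: "r1 \<in> W21" "solves_ae a lam (\<lambda>t. 0) r1" using r1 by (auto simp: is_r1_def)
    have vW: "v \<in> W21" using v by (simp add: X_D_def)
    show "(\<lambda>t. v t + u 0 * r1 t) \<in> W21" by (rule W21_add_cmult[OF vW r(1)])
    show "solves_ae a lam F (\<lambda>t. v t + u 0 * r1 t)"
      using solves_ae_add_cmult[OF vW v(2) r] by simp
    show "u 0 = v 0 + u 0 * r1 0" "u 1 = v 1 + u 0 * r1 1"
      using u v r1 by (auto simp: X_D_def X_M1_def is_r1_def)
  qed (use u in \<open>auto simp: X_M1_def\<close>)
  then have "integral unit_I (\<lambda>s. G_M1 t s * F s)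
      - integral unit_I (\<lambda>s. G_D t s * F s) - r1 t * integral unit_I (\<lambda>s. G_M1 0 s * F s) = 0"
    using u(3)[of t] u(3)[of 0] v(3)[of t] t by (simp add: mult.commute)
  moreover have "integral unit_I (\<lambda>s. F s * F s) = integral unit_I (\<lambda>s. G_M1 t s * F s)
      - integral unit_I (\<lambda>s. G_D t s * F s) - r1 t * integral unit_I (\<lambda>s. G_M1 0 s * F s)"
  proof -
    have "((\<lambda>s. G_M1 t s * F s - G_D t s * F s - r1 t * (G_M1 0 s * F s)) has_integral
      integral unit_I (\<lambda>s. G_M1 t s * F s) - integral unit_I (\<lambda>s. G_D t s * F s)
        - r1 t * integral unit_I (\<lambda>s. G_M1 0 s * F s)) unit_I"
      by (intro has_integral_diff has_integral_mult_right integrable_integral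
          integrable_continuous_real continuous_on_mult cM cM0 cD F)
    also have "(\<lambda>s. G_M1 t s * F s - G_D t s * F s - r1 t * (G_M1 0 s * F s)) = (\<lambda>s. F s * F s)"
      by (simp add: F_def algebra_simps)
    finally show ?thesis by (simp add: integral_unique)
  qed
  ultimately have "integral unit_I (\<lambda>s. F s * F s) = 0" by simp
  moreover have "continuous_on unit_I (\<lambda>s. F s * F s)"
    by (intro continuous_intros F)
  ultimately have "F s * F s = 0"
    using integral_eq_0_iff[of 0 1 "\<lambda>s. F s * F s"] s by simp
  then have "F s = 0" by simp
  then show ?thesis unfolding F_def by linarith
qed

text \<open>
  Here \<open>r1 * \<Phi>\<close> is, near 0, the homogeneous solution with value 0 and slope 1 at 0,
  obtained from \<open>r1\<close> by reduction of order. The test solutions are \<open>r1 * w\<close> with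
  \<open>r1\<^sup>2 * w' = P\<close> and \<open>P' = q\<close>, for an arbitrary continuous \<open>q\<close> that vanishes on
  \<open>{c..1}\<close>. Such a function satisfies \<open>L (r1 * w) = q / r1\<close>, and its value at
  \<open>t0 \<ge> c\<close> is \<open>- r1 t0\<close> times the integral of \<open>q * \<Phi>\<close>.
\<close>

lemma Green_D_near_0:
  assumes nr: "nonresonant a lam X_D" and GD: "is_Green a lam X_D G_D"
    and r1: "is_r1 a lam r1"
    and t0: "t0 \<in> {0<..<1}"
  obtains c \<Phi> where "0 < c" "c < 1" "(\<Phi> has_real_derivative 1) (at 0 within unit_I)" "\<Phi> 0 = 0"
    "\<And>s. s \<in> {0..<c} \<Longrightarrow> G_D t0 s = - r1 t0 * (r1 s * \<Phi> s)"
proof -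
  have rW: "r1 \<in> W21" and rsol: "solves_ae a lam (\<lambda>t. 0) r1" and r0: "r1 0 = 1" and r1_1: "r1 1 = 0"
    using r1 by (auto simp: is_r1_def)
  have rd: "(r1 has_real_derivative D1 r1 t) (at t within unit_I)" if "t \<in> unit_I" for t
    using W21_has_derivative[OF rW that] .
  have r'ac: "abs_continuous_on unit_I (D1 r1)" using rW by (simp add: W21_def)
  have rc: "continuous_on unit_I r1" using rW by (simp add: W21_def)
  have rac: "abs_continuous_on unit_I r1"
    using C1_imp_abs_continuous_on[OF rd] abs_continuous_on_imp_continuous_on[OF r'ac] by blast
  obtain d where d: "d > 0" "\<And>x. x \<in> unit_I \<Longrightarrow> dist x 0 < d \<Longrightarrow> dist (r1 x) (r1 0) < 1/2"
    using rc unfolding continuous_on_iff by (metis atLeastAtMost_iff half_gt_zero_iff order_refl zero_less_one zero_le_one)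
  \<comment> \<open>\<open>c\<close> keeps \<open>r1\<close> above 1/2 on \<open>{0..c}\<close> and keeps \<open>t0\<close> to the right of \<open>{0..<c}\<close>.\<close>
  define c where "c = min t0 (d / 2)"
  have c: "0 < c" "c \<le> t0" "c < d" "c < 1" using d t0 by (auto simp: c_def)
  have rbig: "r1 t > 1/2" if "t \<in> {0..c}" for t
    using d(2)[of t] that c r0 by (auto simp: dist_real_def abs_if split: if_splits)
  \<comment> \<open>\<open>r1\<close> may vanish beyond \<open>c\<close>. The cut-off \<open>R\<close> agrees with it on \<open>{0..c}\<close> and can be
    divided by everywhere; where the two differ, \<open>P\<close> and \<open>q\<close> are 0.\<close>
  define R where "R = (\<lambda>t. max (r1 t) (1/2))"
  have Rpos: "R t \<ge> 1/2" and Rnz: "R t \<noteq> 0" for t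
    unfolding R_def by (auto simp: max_def)
  have RcI: "R t = r1 t" if "t \<in> {0..c}" for t using rbig[OF that] by (simp add: R_def)
  have Rcont: "continuous_on unit_I R"
    unfolding R_def by (intro continuous_intros rc)
  have Rac: "abs_continuous_on unit_I (\<lambda>t. 1 / R t)"
  proof (rule abs_continuous_on_dominated[OF rac rac, of 4])
    fix x y
    have "R x * R y \<ge> 1/2 * (1/2)"
      using Rpos by (intro mult_mono) (auto intro: order_trans[OF _ Rpos])
    then have prod: "R x * R y \<ge> 1/4" by simp
    have "1 / R y - 1 / R x = (R x - R y) / (R x * R y)"
      using Rnz by (simp add: field_simps)
    then have "\<bar>1 / R y - 1 / R x\<bar> = \<bar>R y - R x\<bar> / (R x * R y)"
      using prod by (simp add: abs_minus_commute)
    also have "\<dots> \<le> \<bar>R y - R x\<bar> / (1/4)"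
      using prod by (intro divide_left_mono) auto
    also have "\<dots> \<le> 4 * \<bar>r1 y - r1 x\<bar> + 4 * \<bar>r1 y - r1 x\<bar>"
      by (simp add: R_def max_def)
    finally show "\<bar>1 / R y - 1 / R x\<bar> \<le> 4 * \<bar>r1 y - r1 x\<bar> + 4 * \<bar>r1 y - r1 x\<bar>" .
  qed simp
  define \<Phi> where "\<Phi> = (\<lambda>t. integral {0..t} (\<lambda>s. 1 / (R s)\<^sup>2))"
  have \<Phi>d: "(\<Phi> has_real_derivative 1 / (R t)\<^sup>2) (at t within unit_I)" if "t \<in> unit_I" for t
    unfolding \<Phi>_def using that Rnz
    by (intro integral_has_real_derivative continuous_intros Rcont) auto
  have \<Phi>c: "continuous_on unit_I \<Phi>"
    using \<Phi>d by (meson DERIV_continuous_on)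
  have key: "r1 t0 * integral unit_I (\<lambda>s. q s * \<Phi> s) = - integral unit_I (\<lambda>s. G_D t0 s * (q s / R s))"
    if q: "continuous_on unit_I q" and q0: "\<And>s. s \<in> {c..1} \<Longrightarrow> q s = 0" for q
  proof -
    have tail: "integral {0..t} f = integral {0..1} f"
      if f: "continuous_on unit_I f" "\<And>s. s \<in> {c..1} \<Longrightarrow> f s = 0" and t: "t \<in> {c..1}"
      for f :: "real \<Rightarrow> real" and t
    proof -
      have "integral {0..t} f + integral {t..1} f = integral {0..1} f"
        using t c f(1) by (intro Henstock_Kurzweil_Integration.integral_combine integrable_continuous_real) auto
      moreover have "integral {t..1} f = integral {t..1} (\<lambda>_. 0)"
        using f(2) t by (intro integral_cong) auto
      ultimately show ?thesis by simp
    qed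
    have q\<Phi>c: "continuous_on unit_I (\<lambda>s. q s * \<Phi> s)" by (intro continuous_intros q \<Phi>c)
    \<comment> \<open>The primitive of \<open>q\<close> that vanishes to the right of \<open>c\<close>.\<close>
    define P where "P = (\<lambda>t. integral {0..t} q - integral unit_I q)"
    have Pd: "(P has_real_derivative q t) (at t within unit_I)" if "t \<in> unit_I" for t
      unfolding P_def using integral_has_real_derivative[OF q that]
      by (auto intro!: derivative_eq_intros)
    have P0: "P t = 0" if "t \<in> {c..1}" for t
      using tail[OF q q0 that] by (simp add: P_def)
    \<comment> \<open>The primitive of \<open>P / R\<^sup>2\<close> with \<open>w 0 = 0\<close>, written after integration by parts, so
      that its constant value on \<open>{c..1}\<close> can be read off.\<close>
    define w where "w = (\<lambda>t. P t * \<Phi> t - integral {0..t} (\<lambda>s. q s * \<Phi> s))"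
    have wd: "(w has_real_derivative P t / (R t)\<^sup>2) (at t within unit_I)" if "t \<in> unit_I" for t
      unfolding w_def using integral_has_real_derivative[OF q\<Phi>c that] Pd[OF that] \<Phi>d[OF that]
      by (auto intro!: derivative_eq_intros)
    have w1: "w t = - integral unit_I (\<lambda>s. q s * \<Phi> s)" if "t \<in> {c..1}" for t
      using P0[OF that] tail[OF q\<Phi>c _ that] q0 by (simp add: w_def)
    define u where "u = (\<lambda>t. r1 t * w t)"
    define u' where "u' = (\<lambda>t. D1 r1 t * w t + P t * (1 / R t))"
    have rwR: "r1 t * (P t / (R t)\<^sup>2) = P t * (1 / R t)" if "t \<in> unit_I" for t
      using RcI[of t] P0[of t] Rnz[of t] that by (cases "t \<le> c") (auto simp: power2_eq_square)
    have ud: "(u has_real_derivative u' t) (at t within unit_I)" if "t \<in> unit_I" for t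
      unfolding u_def u'_def using DERIV_mult[OF rd[OF that] wd[OF that]] rwR[OF that]
      by (simp add: mult.commute)
    have Pac: "abs_continuous_on unit_I P"
      using C1_imp_abs_continuous_on[OF Pd q] .
    have "continuous_on unit_I (\<lambda>t. P t / (R t)\<^sup>2)"
      using Rnz abs_continuous_on_imp_continuous_on[OF Pac] by (intro continuous_intros Rcont) auto
    then have wac: "abs_continuous_on unit_I w"
      using C1_imp_abs_continuous_on[OF wd] by blast
    have u'ac: "abs_continuous_on unit_I u'"
      using abs_continuous_on_add_cmult[OF abs_continuous_on_mult[OF r'ac wac]
          abs_continuous_on_mult[OF Pac Rac], of 1]
      by (simp add: u'_def)
    have uW: "u \<in> W21" by (rule W21I[OF ud u'ac])
    have usol: "solves_ae a lam (\<lambda>t. q t / R t) u"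
    proof (rule solves_aeI[OF ud])
      show "AE t in lebesgue_on unit_I. t \<in> unit_I \<longrightarrow>
        (u' has_real_derivative q t / R t - (a t + lam) * u t) (at t within unit_I)"
        using solves_aeD[OF rsol]
      proof (rule AE_mp, intro AE_I2 impI)
        fix t assume t: "t \<in> unit_I" and "t \<in> unit_I \<longrightarrow>
          (D1 r1 has_real_derivative 0 - (a t + lam) * r1 t) (at t within unit_I)"
        then have r'd: "(D1 r1 has_real_derivative - ((a t + lam) * r1 t)) (at t within unit_I)"
          by simp
        \<comment> \<open>\<open>R\<close> need not be differentiable where \<open>r1 = 1/2\<close>, but the quotient \<open>P / R\<close> is:
          such points lie to the right of \<open>c\<close>, where \<open>P\<close> vanishes locally.\<close>
        have PR: "((\<lambda>t. P t * (1 / R t)) has_real_derivative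
            q t / R t - D1 r1 t * (P t / (R t)\<^sup>2)) (at t within unit_I)"
        proof (cases "t \<le> c")
          case True
          then have rt: "r1 t > 1/2" using rbig t by simp
          obtain e where e: "e > 0" "\<And>x. x \<in> unit_I \<Longrightarrow> dist x t < e \<Longrightarrow> dist (r1 x) (r1 t) < r1 t - 1/2"
            using rc t rt unfolding continuous_on_iff by (metis diff_gt_0_iff_gt)
          have "(R has_real_derivative D1 r1 t) (at t within unit_I)"
            using rd[OF t] e(1) t
          proof (rule has_field_derivative_transform_within)
            fix x assume "x \<in> unit_I" "dist x t < e"
            then show "r1 x = R x"
              using e(2)[of x] by (auto simp: R_def dist_real_def)
          qed
          then show ?thesis
            using Pd[OF t] Rnz[of t]
            by (auto intro!: derivative_eq_intros simp: power2_eq_square field_simps)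
        next
          case False
          then have "P t = 0" "q t = 0" using P0[of t] q0[of t] t by auto
          moreover have "((\<lambda>t. P t * (1 / R t)) has_real_derivative 0) (at t within unit_I)"
          proof (rule has_field_derivative_transform_within[of "\<lambda>_. 0" _ _ _ "t - c"])
            fix x assume "x \<in> unit_I" "dist x t < t - c"
            then show "0 = P x * (1 / R x)"
              using P0[of x] by (auto simp: dist_real_def)
          qed (use False t in auto)
          ultimately show ?thesis by simp
        qed
        show "(u' has_real_derivative q t / R t - (a t + lam) * u t) (at t within unit_I)"
          unfolding u'_def u_def using DERIV_add[OF DERIV_mult[OF r'd wd[OF t]] PR]
          by (simp add: algebra_simps)
      qed
    qed
    have qR: "continuous_on unit_I (\<lambda>t. q t / R t)"
      using Rnz by (intro continuous_intros q Rcont) auto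
    obtain v where v: "v \<in> X_D" "solves_ae a lam (\<lambda>t. q t / R t) v"
      "\<And>t. t \<in> unit_I \<Longrightarrow> v t = integral unit_I (\<lambda>s. G_D t s * (q s / R s))"
      using Green_solution[OF GD qR] by blast
    have \<Phi>0: "\<Phi> 0 = 0" by (simp add: \<Phi>_def)
    have "u t0 = v t0"
      using nonresonant_unique[OF nr uW usol _ v(2)] v(1) t0
      by (auto simp: X_D_def u_def w_def \<Phi>0 r1_1)
    then show ?thesis
      using v(3)[of t0] w1[of t0] t0 c by (simp add: u_def)
  qed
  \<comment> \<open>By \<open>key\<close>, \<open>F\<close> is orthogonal to all admissible \<open>q\<close>. The factor \<open>max (c - s) 0\<close> makes
    \<open>q\<close> admissible and leaves the integrand \<open>F * q\<close> nonnegative.\<close>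
  define F where "F = (\<lambda>s. G_D t0 s / R s + r1 t0 * \<Phi> s)"
  define q where "q = (\<lambda>s. F s * max (c - s) 0)"
  have Gc: "continuous_on unit_I (G_D t0)"
    using Green_continuous_snd[OF GD] t0 by auto
  have Fc: "continuous_on unit_I F"
    unfolding F_def using Rnz by (intro continuous_intros Gc Rcont \<Phi>c) auto
  have qc: "continuous_on unit_I q"
    unfolding q_def by (intro continuous_intros Fc)
  have "((\<lambda>s. G_D t0 s * (q s / R s) + r1 t0 * (q s * \<Phi> s)) has_integral
      integral unit_I (\<lambda>s. G_D t0 s * (q s / R s)) + r1 t0 * integral unit_I (\<lambda>s. q s * \<Phi> s)) unit_I"
    using Rnz by (intro has_integral_add has_integral_mult_right integrable_integral
        integrable_continuous_real continuous_intros Gc qc Rcont \<Phi>c) auto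
  also have "integral unit_I (\<lambda>s. G_D t0 s * (q s / R s)) + r1 t0 * integral unit_I (\<lambda>s. q s * \<Phi> s) = 0"
    using key[OF qc] by (simp add: q_def)
  also have "(\<lambda>s. G_D t0 s * (q s / R s) + r1 t0 * (q s * \<Phi> s)) = (\<lambda>s. F s * F s * max (c - s) 0)"
    by (simp add: F_def q_def add_divide_distrib algebra_simps)
  finally have "integral unit_I (\<lambda>s. F s * F s * max (c - s) 0) = 0"
    by (rule integral_unique)
  moreover have "continuous_on unit_I (\<lambda>s. F s * F s * max (c - s) 0)"
    by (intro continuous_intros Fc)
  ultimately have F0: "F s * F s * max (c - s) 0 = 0" if "s \<in> unit_I" for s
    using integral_eq_0_iff[of 0 1 "\<lambda>s. F s * F s * max (c - s) 0"] that by simp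
  show ?thesis
  proof (rule that[of c \<Phi>])
    show "(\<Phi> has_real_derivative 1) (at 0 within unit_I)"
      using \<Phi>d[of 0] RcI[of 0] r0 c by simp
    show "\<Phi> 0 = 0" by (simp add: \<Phi>_def)
    show "G_D t0 s = - r1 t0 * (r1 s * \<Phi> s)" if s: "s \<in> {0..<c}" for s
    proof -
      have "F s = 0" using F0[of s] s c by (auto simp: max_def)
      then show ?thesis
        using Rnz[of s] RcI[of s] s by (auto simp: F_def field_simps add_eq_0_iff)
    qed
  qed (use c in auto)
qed

lemma Green_D_deriv_0:
  assumes nr: "nonresonant a lam X_D" and GD: "is_Green a lam X_D G_D"
    and r1: "is_r1 a lam r1" and t: "t \<in> {0<..<1}"
  shows "(G_D t has_real_derivative - r1 t) (at 0 within unit_I)"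
proof -
  obtain c \<Phi> where c: "0 < c" "c < 1" and \<Phi>: "(\<Phi> has_real_derivative 1) (at 0 within unit_I)" "\<Phi> 0 = 0"
    and eq: "\<And>s. s \<in> {0..<c} \<Longrightarrow> G_D t s = - r1 t * (r1 s * \<Phi> s)"
    using Green_D_near_0[OF assms] by metis
  have r: "(r1 has_real_derivative D1 r1 0) (at 0 within unit_I)" "r1 0 = 1"
    using r1 W21_has_derivative[of r1 0] by (auto simp: is_r1_def)
  have "((\<lambda>s. - r1 t * (r1 s * \<Phi> s)) has_real_derivative - r1 t) (at 0 within unit_I)"
    using r \<Phi> by (auto intro!: derivative_eq_intros)
  then show ?thesis
    by (rule has_field_derivative_transform_within[of _ _ _ _ c])
       (use c eq in \<open>auto simp: dist_real_def\<close>)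
qed

text \<open>
  At the end points the extension by continuity is the value of \<open>- r1\<close>, because \<open>r1\<close> is
  continuous there.
\<close>

lemma ds0_Green_D:
  assumes nr: "nonresonant a lam X_D" and GD: "is_Green a lam X_D G_D"
    and r1: "is_r1 a lam r1"
  shows "ds0_exists G_D" and "\<And>t. t \<in> unit_I \<Longrightarrow> ds0 G_D t = - r1 t"
proof -
  note d = Green_D_deriv_0[OF nr GD r1]
  have vd: "vector_derivative (G_D t) (at 0 within unit_I) = - r1 t" if "t \<in> {0<..<1}" for t
    using D1_eqI[OF d[OF that]] by (simp add: D1_def)
  have lim: "((\<lambda>\<tau>. vector_derivative (G_D \<tau>) (at 0 within unit_I)) \<longlongrightarrow> - r1 t) (at t within {0<..<1})"
    if "t \<in> unit_I" for t
  proof -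
    have "continuous_on unit_I r1" using r1 by (simp add: is_r1_def W21_def)
    then have "(r1 \<longlongrightarrow> r1 t) (at t within {0<..<1})"
      using that by (auto simp: continuous_on_def intro: tendsto_within_subset[where S = unit_I])
    then have "((\<lambda>\<tau>. - r1 \<tau>) \<longlongrightarrow> - r1 t) (at t within {0<..<1})"
      by (rule tendsto_minus)
    then show ?thesis
      by (rule Lim_transform_eventually) (auto simp: eventually_at_filter vd)
  qed
  have end_lim: "ds0 G_D t = - r1 t" if "t \<in> {0, 1}" for t
  proof -
    have "at t within {0<..<1} \<noteq> bot"
      using that by (auto simp: trivial_limit_within islimpt_greaterThanLessThan1 islimpt_greaterThanLessThan2)
    moreover have "t \<in> unit_I" "t \<notin> {0<..<1}" using that by auto
    ultimately show ?thesis
      using tendsto_Lim[OF _ lim[of t]] by (simp add: ds0_def del: greaterThanLessThan_iff)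
  qed
  show *: "ds0 G_D t = - r1 t" if "t \<in> unit_I" for t
    using that end_lim[of t] vd[of t] by (cases "t \<in> {0<..<1}") (auto simp: ds0_def)
  show "ds0_exists G_D"
    unfolding ds0_exists_def
  proof (intro conjI ballI)
    show "G_D t differentiable (at 0 within unit_I)" if "t \<in> {0<..<1}" for t
      using d[OF that] real_differentiable_def by blast
    show "((\<lambda>\<tau>. vector_derivative (G_D \<tau>) (at 0 within unit_I)) \<longlongrightarrow> ds0 G_D t) (at t within {0<..<1})"
      if "t \<in> {0, 1}" for t
      using lim[of t] *[of t] that by auto
  qed
qed

theorem theorem3p17:
  fixes a :: "real \<Rightarrow> real" and lam :: real
    and G_D G_M1 :: "real \<Rightarrow> real \<Rightarrow> real" and r1 :: "real \<Rightarrow> real"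
  assumes "a absolutely_integrable_on unit_I"
    and "nonresonant a lam X_D"
    and "nonresonant a lam X_M1"
    and "is_Green a lam X_D G_D"
    and "is_Green a lam X_M1 G_M1"
    and "is_r1 a lam r1"
  shows "ds0_exists G_D \<and>
    (\<forall>t\<in>unit_I. \<forall>s\<in>unit_I.
       G_M1 t s = G_D t s + r1 t * G_M1 0 s \<and>
       G_D t s + r1 t * G_M1 0 s = G_D t s - ds0 G_D t * G_M1 0 s)"
proof (intro conjI ballI)
  show "ds0_exists G_D"
    by (rule ds0_Green_D(1)[OF assms(2,4,6)])
  fix t s :: real assume t: "t \<in> unit_I" and s: "s \<in> unit_I"
  show "G_M1 t s = G_D t s + r1 t * G_M1 0 s"
    by (rule Green_M1_eq[OF assms(2,4,5,6) t s])
  show "G_D t s + r1 t * G_M1 0 s = G_D t s - ds0 G_D t * G_M1 0 s"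
    by (simp add: ds0_Green_D(2)[OF assms(2,4,6) t])
qed

end
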